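(* Let $M$ be a smooth $m$-dimensional manifold and let $F:M\to(\mathbb{R}^n,\langle\cdot,\cdot\rangle)$ be an immersion such that $g:=F^*\langle\cdot,\cdot\rangle$ is nondegenerate and $\|F\|^2=k$ is constant with $k>0$. Then the solution of the mean curvature flow with initial immersion $F$ is a homothety if and only if $F:M\to\mathcal{H}^{n-1}(k)$ is a minimal immersion in the hyperquadric $\mathcal{H}^{n-1}(k)$. In this case the mean curvature flow of $F$ has a solution $F:M\times[0,T)\to(\mathbb{R}^n,\langle\cdot,\cdot\rangle)$ with $T=\frac{k}{2m}$, and the solution is $F(x,t)=c^{-1}(t)F(x)$ with $c(t)=\sqrt{k}\,(k-2mt)^{-1/2}$ for all $(x,t)\in M\times[0,T)$.
   Context: $\langle\cdot,\cdot\rangle$ is a nondegenerate symmetric bilinear form on $\mathbb{R}^n$ (not necessarily definite); $\|X\|^2=\langle X,X\rangle$; $\mathcal{H}^{n-1}(k)=\{x\in\mathbb{R}^n:\|x\|^2=k\}$. "Minimal" means that the mean curvature vector of $F$ as an immersion into the semi-Riemannian hypersurface $\mathcal{H}^{n-1}(k)$ vanishes. $M$ is connected, orientable and complete, of positive dimension. A solution of the mean curvature flow with initial immersion $F_0:M\to(\mathbb{R}^n,\langle\cdot,\cdot\rangle)$ is a smooth family of immersions $F:M\times[0,T)\to\mathbb{R}^n$, $T>0$, with $F(\cdot,t)^*\langle\cdot,\cdot\rangle$ nondegenerate for all $t$, $\frac{dF}{dt}(p,t)=\vec H(p,t)$ and $F(p,0)=F_0(p)$, where $\vec H(\cdot,t)$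 is the mean curvature vector (trace of the second fundamental tensor) of $F(\cdot,t)$. Such a solution is a homothety if there is a differentiable $c:[0,T)\to(0,\infty)$ with $c(0)=1$ and $\vec H=-\frac{\dot c}{c}F^\perp$, where $F^\perp$ is the normal part of the position vector. "The solution of the mean curvature flow is a homothety" is understood as: the mean curvature flow with this initial immersion has a solution which is a homothety (it is then unique among homothetic solutions on a given time interval). *)

theory Defs
  imports "HOL-Analysis.Analysis"
begin

section \<open>Smooth maps and smooth manifolds\<close>

primrec Ck_on :: "nat \<Rightarrow> 'a::real_normed_vector set \<Rightarrow> ('a \<Rightarrow> 'b::real_normed_vector) \<Rightarrow> bool" where
  "Ck_on 0 S f \<longleftrightarrow> continuous_on S f"
| "Ck_on (Suc k) S f \<longleftrightarrow>
     (\<forall>x\<in>S. f differentiable (at x)) \<and> (\<forall>v. Ck_on k S (\<lambda>x. frechet_derivative f (at x) v))"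

text \<open>\<^const>\<open>Ck_on\<close> is only meaningful on open sets. On an arbitrary set, such as
  a product of an open set with a half-open time interval, a map is smooth if it has smooth
  extensions to open sets locally around each point.\<close>

definition smooth_on :: "'a::real_normed_vector set \<Rightarrow> ('a \<Rightarrow> 'b::real_normed_vector) \<Rightarrow> bool" where
  "smooth_on S f \<longleftrightarrow>
     (\<forall>x\<in>S. \<exists>W g. open W \<and> x \<in> W \<and> (\<forall>k. Ck_on k W g) \<and> (\<forall>y\<in>W \<inter> S. g y = f y))"

text \<open>A chart is a pair of a domain and a coordinate map. The dimension of the manifold is
  the (automatically positive) dimension \<open>CARD('m)\<close> of the model space.\<close>

type_synonym ('a, 'm) chart = "'a set \<times> ('a \<Rightarrow> real ^ 'm)"

abbreviation chart_dom :: "('a, 'm) chart \<Rightarrow> 'a set" where "chart_dom c \<equiv> fst c"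
abbreviation coord :: "('a, 'm) chart \<Rightarrow> 'a \<Rightarrow> real ^ 'm" where "coord c \<equiv> snd c"
abbreviation chart_image :: "('a, 'm) chart \<Rightarrow> (real ^ 'm) set" where "chart_image c \<equiv> coord c ` chart_dom c"
abbreviation param :: "('a, 'm) chart \<Rightarrow> real ^ 'm \<Rightarrow> 'a" where
  "param c \<equiv> inv_into (chart_dom c) (coord c)"

definition is_chart :: "'a topology \<Rightarrow> ('a, 'm::finite) chart \<Rightarrow> bool" where
  "is_chart M c \<longleftrightarrow> openin M (chart_dom c) \<and> open (chart_image c) \<and>
     homeomorphic_map (subtopology M (chart_dom c)) (top_of_set (chart_image c)) (coord c)"

definition smooth_atlas :: "'a topology \<Rightarrow> ('a, 'm::finite) chart set \<Rightarrow> bool" where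
  "smooth_atlas M A \<longleftrightarrow> (\<forall>c\<in>A. is_chart M c) \<and> (\<Union>c\<in>A. chart_dom c) = topspace M \<and>
     (\<forall>c\<in>A. \<forall>d\<in>A. smooth_on (coord c ` (chart_dom c \<inter> chart_dom d)) (coord d \<circ> param c))"

definition smooth_manifold :: "'a topology \<Rightarrow> ('a, 'm::finite) chart set \<Rightarrow> bool" where
  "smooth_manifold M A \<longleftrightarrow> Hausdorff_space M \<and> second_countable M \<and> smooth_atlas M A"

definition orientable :: "'a topology \<Rightarrow> ('a, 'm::finite) chart set \<Rightarrow> bool" where
  "orientable M A \<longleftrightarrow> (\<exists>A'. smooth_atlas M A' \<and> smooth_atlas M (A \<union> A') \<and>
     (\<forall>c\<in>A'. \<forall>d\<in>A'. \<forall>x\<in>coord c ` (chart_dom c \<inter> chart_dom d).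
        det (matrix (frechet_derivative (coord d \<circ> param c) (at x))) > 0))"

text \<open>A chosen chart around a point; what is computed in it below is independent of the choice.\<close>

definition chart_at :: "('a, 'm) chart set \<Rightarrow> 'a \<Rightarrow> ('a, 'm) chart" where
  "chart_at A p = (SOME c. c \<in> A \<and> p \<in> chart_dom c)"

definition pd :: "'m::finite \<Rightarrow> (real ^ 'm \<Rightarrow> 'b::real_normed_vector) \<Rightarrow> real ^ 'm \<Rightarrow> 'b" where
  "pd i f x = frechet_derivative f (at x) (axis i 1)"

section \<open>Geodesic completeness\<close>

text \<open>A semi-Riemannian metric is given by its coefficient matrix in every chart.\<close>

type_synonym ('a, 'm) metric_coeffs = "('a, 'm) chart \<Rightarrow> real ^ 'm \<Rightarrow> real ^ 'm ^ 'm"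

definition christoffel ::
  "('a, 'm::finite) metric_coeffs \<Rightarrow> ('a, 'm) chart \<Rightarrow> real ^ 'm \<Rightarrow> 'm \<Rightarrow> 'm \<Rightarrow> 'm \<Rightarrow> real" where
  "christoffel g c x k i j = (1 / 2) * (\<Sum>l\<in>UNIV. matrix_inv (g c x) $ k $ l *
     (pd i (\<lambda>y. g c y $ j $ l) x + pd j (\<lambda>y. g c y $ i $ l) x - pd l (\<lambda>y. g c y $ i $ j) x))"

definition geodesic ::
  "'a topology \<Rightarrow> ('a, 'm::finite) chart set \<Rightarrow> ('a, 'm) metric_coeffs \<Rightarrow> (real \<Rightarrow> 'a) \<Rightarrow> bool" where
  "geodesic M A g \<gamma> \<longleftrightarrow> continuous_map euclideanreal M \<gamma> \<and>
     (\<forall>c\<in>A. smooth_on {t. \<gamma> t \<in> chart_dom c} (coord c \<circ> \<gamma>) \<and>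
       (\<forall>t. \<gamma> t \<in> chart_dom c \<longrightarrow>
         (let \<gamma>' = (\<lambda>s. vector_derivative (coord c \<circ> \<gamma>) (at s))
          in vector_derivative \<gamma>' (at t) =
               (\<chi> k. - (\<Sum>i\<in>UNIV. \<Sum>j\<in>UNIV.
                  christoffel g c (coord c (\<gamma> t)) k i j * \<gamma>' t $ i * \<gamma>' t $ j)))))"

definition geodesically_complete ::
  "'a topology \<Rightarrow> ('a, 'm::finite) chart set \<Rightarrow> ('a, 'm) metric_coeffs \<Rightarrow> bool" where
  "geodesically_complete M A g \<longleftrightarrow> (\<forall>p\<in>topspace M. \<forall>v. \<exists>\<gamma>.
     geodesic M A g \<gamma> \<and> \<gamma> 0 = p \<and> vector_derivative (coord (chart_at A p) \<circ> \<gamma>) (at 0) = v)"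

section \<open>Immersions into a pseudo-Euclidean space\<close>

definition nondegenerate_form :: "('v::real_vector \<Rightarrow> 'v \<Rightarrow> real) \<Rightarrow> bool" where
  "nondegenerate_form B \<longleftrightarrow> bilinear B \<and> (\<forall>v w. B v w = B w v) \<and> (\<forall>v. (\<forall>w. B v w = 0) \<longrightarrow> v = 0)"

abbreviation local_rep :: "('a \<Rightarrow> 'b) \<Rightarrow> ('a, 'm) chart \<Rightarrow> real ^ 'm \<Rightarrow> 'b" where
  "local_rep F c \<equiv> F \<circ> param c"

definition smooth_immersion :: "('a, 'm::finite) chart set \<Rightarrow> ('a \<Rightarrow> real ^ 'n) \<Rightarrow> bool" where
  "smooth_immersion A F \<longleftrightarrow> (\<forall>c\<in>A. smooth_on (chart_image c) (local_rep F c) \<and>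
     (\<forall>x\<in>chart_image c. inj (frechet_derivative (local_rep F c) (at x))))"

definition nondegenerate_immersion ::
  "(real ^ 'n \<Rightarrow> real ^ 'n \<Rightarrow> real) \<Rightarrow> ('a, 'm::finite) chart set \<Rightarrow> ('a \<Rightarrow> real ^ 'n) \<Rightarrow> bool" where
  "nondegenerate_immersion B A F \<longleftrightarrow> smooth_immersion A F \<and>
     (\<forall>c\<in>A. \<forall>x\<in>chart_image c. let dF = frechet_derivative (local_rep F c) (at x)
        in \<forall>v. (\<forall>w. B (dF v) (dF w) = 0) \<longrightarrow> v = 0)"

definition induced_metric ::
  "(real ^ 'n \<Rightarrow> real ^ 'n \<Rightarrow> real) \<Rightarrow> ('a \<Rightarrow> real ^ 'n) \<Rightarrow> ('a, 'm::finite) metric_coeffs" where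
  "induced_metric B F c x = (\<chi> i j. B (pd i (local_rep F c) x) (pd j (local_rep F c) x))"

text \<open>The orthogonal projection onto a subspace on which \<open>B\<close> is nondegenerate.\<close>

definition orth_proj :: "('v::real_vector \<Rightarrow> 'v \<Rightarrow> real) \<Rightarrow> 'v set \<Rightarrow> 'v \<Rightarrow> 'v" where
  "orth_proj B V v = (THE u. u \<in> V \<and> (\<forall>w\<in>V. B (v - u) w = 0))"

text \<open>The tangent space of an embedded submanifold \<open>N\<close>, as the set of velocities of curves in \<open>N\<close>.\<close>

definition tangent_space :: "'v::real_normed_vector set \<Rightarrow> 'v \<Rightarrow> 'v set" where
  "tangent_space N y = {v. \<exists>\<gamma> e. e > 0 \<and> smooth_on {-e<..<e} \<gamma> \<and> \<gamma> ` {-e<..<e} \<subseteq> N \<and>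
     \<gamma> 0 = y \<and> (\<gamma> has_vector_derivative v) (at (0::real))}"

definition hyperquadric :: "('v \<Rightarrow> 'v \<Rightarrow> real) \<Rightarrow> real \<Rightarrow> 'v set" where
  "hyperquadric B k = {x. B x x = k}"

section \<open>Second fundamental tensor and mean curvature\<close>

text \<open>In the following, \<open>F\<close> is an immersion into a semi-Riemannian submanifold \<open>N\<close> of the
  pseudo-Euclidean space; the pseudo-Euclidean space itself is the case \<open>N = UNIV\<close>.\<close>

definition normal_space ::
  "(real ^ 'n \<Rightarrow> real ^ 'n \<Rightarrow> real) \<Rightarrow> (real ^ 'n) set \<Rightarrow> ('a \<Rightarrow> real ^ 'n) \<Rightarrow>
   ('a, 'm::finite) chart \<Rightarrow> real ^ 'm \<Rightarrow> (real ^ 'n) set" where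
  "normal_space B N F c x = {w \<in> tangent_space N (local_rep F c x).
     \<forall>v. B w (frechet_derivative (local_rep F c) (at x) v) = 0}"

text \<open>The Levi-Civita connection of \<open>N\<close> is the tangential part of the flat connection, so the
  inner projection is the covariant derivative, in \<open>N\<close>, of the \<open>j\<close>-th coordinate vector field
  along the \<open>i\<close>-th one. The second fundamental tensor is its normal part.\<close>

definition second_fundamental ::
  "(real ^ 'n \<Rightarrow> real ^ 'n \<Rightarrow> real) \<Rightarrow> (real ^ 'n) set \<Rightarrow> ('a \<Rightarrow> real ^ 'n) \<Rightarrow>
   ('a, 'm::finite) chart \<Rightarrow> real ^ 'm \<Rightarrow> 'm \<Rightarrow> 'm \<Rightarrow> real ^ 'n" where
  "second_fundamental B N F c x i j = orth_proj B (normal_space B N F c x)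
     (orth_proj B (tangent_space N (local_rep F c x)) (pd i (pd j (local_rep F c)) x))"

definition mean_curvature ::
  "(real ^ 'n \<Rightarrow> real ^ 'n \<Rightarrow> real) \<Rightarrow> (real ^ 'n) set \<Rightarrow> ('a, 'm::finite) chart set \<Rightarrow>
   ('a \<Rightarrow> real ^ 'n) \<Rightarrow> 'a \<Rightarrow> real ^ 'n" where
  "mean_curvature B N A F p = (let c = chart_at A p; x = coord c p in
     \<Sum>i\<in>UNIV. \<Sum>j\<in>UNIV. matrix_inv (induced_metric B F c x) $ i $ j *\<^sub>R second_fundamental B N F c x i j)"

definition normal_part ::
  "(real ^ 'n \<Rightarrow> real ^ 'n \<Rightarrow> real) \<Rightarrow> ('a, 'm::finite) chart set \<Rightarrow>
   ('a \<Rightarrow> real ^ 'n) \<Rightarrow> 'a \<Rightarrow> real ^ 'n" where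
  "normal_part B A F p = (let c = chart_at A p in
     orth_proj B (normal_space B UNIV F c (coord c p)) (F p))"

definition minimal_immersion ::
  "(real ^ 'n \<Rightarrow> real ^ 'n \<Rightarrow> real) \<Rightarrow> (real ^ 'n) set \<Rightarrow> 'a topology \<Rightarrow>
   ('a, 'm::finite) chart set \<Rightarrow> ('a \<Rightarrow> real ^ 'n) \<Rightarrow> bool" where
  "minimal_immersion B N M A F \<longleftrightarrow> nondegenerate_immersion B A F \<and>
     (\<forall>p\<in>topspace M. F p \<in> N \<and> mean_curvature B N A F p = 0)"

section \<open>Mean curvature flow and homotheties\<close>

text \<open>The end \<open>T\<close> of the existence interval may be infinite.\<close>

definition time_interval :: "ereal \<Rightarrow> real set" where
  "time_interval T = {t. 0 \<le> t \<and> ereal t < T}"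

definition mcf_solution ::
  "(real ^ 'n \<Rightarrow> real ^ 'n \<Rightarrow> real) \<Rightarrow> 'a topology \<Rightarrow> ('a, 'm::finite) chart set \<Rightarrow>
   ('a \<Rightarrow> real ^ 'n) \<Rightarrow> ereal \<Rightarrow> ('a \<Rightarrow> real \<Rightarrow> real ^ 'n) \<Rightarrow> bool" where
  "mcf_solution B M A F\<^sub>0 T F \<longleftrightarrow> T > 0 \<and>
     (\<forall>c\<in>A. smooth_on (chart_image c \<times> time_interval T) (\<lambda>(x, t). F (param c x) t)) \<and>
     (\<forall>t\<in>time_interval T. nondegenerate_immersion B A (\<lambda>p. F p t)) \<and>
     (\<forall>p\<in>topspace M. \<forall>t\<in>time_interval T.
        (F p has_vector_derivative mean_curvature B UNIV A (\<lambda>q. F q t) p)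
          (at t within time_interval T)) \<and>
     (\<forall>p\<in>topspace M. F p 0 = F\<^sub>0 p)"

definition homothety_with ::
  "(real ^ 'n \<Rightarrow> real ^ 'n \<Rightarrow> real) \<Rightarrow> 'a topology \<Rightarrow> ('a, 'm::finite) chart set \<Rightarrow>
   ereal \<Rightarrow> ('a \<Rightarrow> real \<Rightarrow> real ^ 'n) \<Rightarrow> (real \<Rightarrow> real) \<Rightarrow> bool" where
  "homothety_with B M A T F c \<longleftrightarrow> c differentiable_on time_interval T \<and>
     (\<forall>t\<in>time_interval T. c t > 0) \<and> c 0 = 1 \<and>
     (\<forall>p\<in>topspace M. \<forall>t\<in>time_interval T.
        mean_curvature B UNIV A (\<lambda>q. F q t) p =
          - (vector_derivative c (at t within time_interval T) / c t) *\<^sub>R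
            normal_part B A (\<lambda>q. F q t) p)"

definition homothety ::
  "(real ^ 'n \<Rightarrow> real ^ 'n \<Rightarrow> real) \<Rightarrow> 'a topology \<Rightarrow> ('a, 'm::finite) chart set \<Rightarrow>
   ereal \<Rightarrow> ('a \<Rightarrow> real \<Rightarrow> real ^ 'n) \<Rightarrow> bool" where
  "homothety B M A T F \<longleftrightarrow> (\<exists>c. homothety_with B M A T F c)"

end

theory Submission
  imports Defs
begin

text \<open>Let \<open>H\<close> be the mean curvature vector of \<open>F\<close> in the ambient space and \<open>H'\<close> the one in
  the hyperquadric. Everything rests on the identity \<open>H' = H + (m / k) F\<close>
  (\<open>mean_curvature_hyperquadric\<close>): differentiating \<open>\<langle>F, F\<rangle> = k\<close> once shows that \<open>F\<close> is normal
  to the immersion, differentiating \<open>\<langle>F, \<partial>\<^sub>jF\<rangle> = 0\<close> shows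
  \<open>\<langle>\<partial>\<^sub>i\<partial>\<^sub>jF, F\<rangle> = - g\<^sub>i\<^sub>j\<close>, so that the second fundamental tensors differ by
  \<open>(g\<^sub>i\<^sub>j / k) F\<close>, and the trace of \<open>g\<close> with respect to itself is \<open>m\<close>.

  If the flow is a homothety, then at time zero \<open>H\<close> is a multiple of the normal part of \<open>F\<close>, which
  is \<open>F\<close> itself; hence \<open>H'\<close> is a multiple of \<open>F\<close> as well. But \<open>H'\<close> is tangent to the
  hyperquadric, that is, orthogonal to \<open>F\<close>, and \<open>\<langle>F, F\<rangle> = k \<noteq> 0\<close>. So \<open>H' = 0\<close>
  (\<open>homothety_imp_minimal\<close>).

  If conversely \<open>H' = 0\<close>, then \<open>H = - (m / k) F\<close>. The mean curvature vector of \<open>s F\<close> is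
  \<open>H / s\<close> (\<open>mean_curvature_scaleR\<close>), so \<open>s(t) F\<close> is a solution of the flow as soon as
  \<open>s s' = - m / k\<close> and \<open>s(0) = 1\<close>. This gives \<open>s\<^sup>2 = (k - 2 m t) / k\<close>, and
  \<open>c = 1 / s\<close> is the function of the theorem (\<open>minimal_imp_shrinking_homothety\<close>).

  Two things have to be supplied on the way. The orthogonal projections are definite
  descriptions, so they must be computed; in a chart this is done with the inverse of the metric
  matrix (\<open>orth_proj_normal_space_UNIV\<close>). And the tangent space of a hyperquadric is
  a set of velocities of smooth curves, so curves with every tangential velocity must be exhibited
  (\<open>tangent_space_hyperquadric\<close>).\<close>

section \<open>Calculus of smooth maps\<close>

lemma frechet_derivative_cong_open:
  assumes "open S" "x \<in> S" "\<And>y. y \<in> S \<Longrightarrow> f y = g y"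
  shows "frechet_derivative f (at x) = frechet_derivative g (at x)"
proof -
  have "(f has_derivative D) (at x) \<longleftrightarrow> (g has_derivative D) (at x)" for D
    using assms has_derivative_transform_within_open[of f D x UNIV S g]
      has_derivative_transform_within_open[of g D x UNIV S f] by auto
  then show ?thesis
    unfolding frechet_derivative_def by simp
qed

lemma differentiable_cong_open:
  assumes "open S" "x \<in> S" "\<And>y. y \<in> S \<Longrightarrow> f y = g y" "f differentiable (at x)"
  shows "g differentiable (at x)"
  using assms has_derivative_transform_within_open[of f _ x UNIV S g]
  unfolding differentiable_def by metis

lemma pd_cong_open:
  assumes "open S" "x \<in> S" "\<And>y. y \<in> S \<Longrightarrow> f y = g y"
  shows "pd i f x = pd i g x"
  using frechet_derivative_cong_open[OF assms] by (simp add: pd_def)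

lemma frechet_derivative_scaleR:
  assumes "f differentiable (at x)"
  shows "frechet_derivative (\<lambda>y. s *\<^sub>R f y) (at x) = (\<lambda>v. s *\<^sub>R frechet_derivative f (at x) v)"
  using has_derivative_scaleR_right[OF assms[unfolded frechet_derivative_works], of s]
  by (rule frechet_derivative_at[symmetric])

text \<open>The recursion defining \<^const>\<open>Ck_on\<close> speaks of a total derivative function, so replacing that
  function by a formula valid on \<open>S\<close> only needs this congruence; it carries
  the inductions over the order of differentiability below.\<close>

lemma Ck_on_cong:
  assumes "open S" "\<And>y. y \<in> S \<Longrightarrow> f y = g y" "Ck_on k S f"
  shows "Ck_on k S g"
  using assms(2,3)
proof (induction k arbitrary: f g)
  case 0
  then show ?case using continuous_on_cong[of S S f g] by simp
next
  case (Suc k)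
  have "frechet_derivative f (at x) = frechet_derivative g (at x)" if "x \<in> S" for x
    using frechet_derivative_cong_open[OF assms(1) that, of f g] Suc.prems(1) by simp
  then have "Ck_on k S (\<lambda>x. frechet_derivative g (at x) v)" for v
    using Suc.IH[of "\<lambda>x. frechet_derivative f (at x) v" "\<lambda>x. frechet_derivative g (at x) v"] Suc.prems(2)
    by simp
  moreover have "g differentiable (at x)" if "x \<in> S" for x
    using differentiable_cong_open[OF assms(1) that] Suc.prems that by auto
  ultimately show ?case by simp
qed

lemma Ck_on_Suc_imp: "Ck_on (Suc k) S f \<Longrightarrow> Ck_on k S f"
proof (induction k arbitrary: f)
  case 0
  then show ?case
    using differentiable_imp_continuous_within by (auto intro!: continuous_at_imp_continuous_on)
next
  case (Suc k)
  then show ?case by simp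
qed

lemma Ck_on_add:
  assumes "open S" "Ck_on k S f" "Ck_on k S g"
  shows "Ck_on k S (\<lambda>x. f x + g x)"
  using assms(2,3)
proof (induction k arbitrary: f g)
  case 0
  then show ?case by (simp add: continuous_on_add)
next
  case (Suc k)
  have D: "((\<lambda>x. f x + g x) has_derivative
      (\<lambda>v. frechet_derivative f (at x) v + frechet_derivative g (at x) v)) (at x)" if "x \<in> S" for x
    using Suc.prems that by (intro has_derivative_add) (auto simp: frechet_derivative_works[symmetric])
  have "Ck_on k S (\<lambda>x. frechet_derivative (\<lambda>x. f x + g x) (at x) v)" for v
    by (rule Ck_on_cong[OF assms(1) _ Suc.IH[of "\<lambda>x. frechet_derivative f (at x) v"
      "\<lambda>x. frechet_derivative g (at x) v"]]) (use Suc.prems in \<open>simp_all add: frechet_derivative_at[OF D, symmetric]\<close>)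
  then show ?case using Suc.prems by simp
qed

lemma Ck_on_scaleR:
  fixes h :: "'a::real_normed_vector \<Rightarrow> real" and f :: "'a \<Rightarrow> 'b::real_normed_vector"
  assumes "open S" "Ck_on k S h" "Ck_on k S f"
  shows "Ck_on k S (\<lambda>x. h x *\<^sub>R f x)"
  using assms(2,3)
proof (induction k arbitrary: f h)
  case 0
  then show ?case by (simp add: continuous_on_scaleR)
next
  case (Suc k)
  have D: "((\<lambda>x. h x *\<^sub>R f x) has_derivative
      (\<lambda>v. h x *\<^sub>R frechet_derivative f (at x) v + frechet_derivative h (at x) v *\<^sub>R f x)) (at x)"
    if "x \<in> S" for x
    using Suc.prems that by (intro has_derivative_scaleR) (auto simp: frechet_derivative_works[symmetric])
  have "Ck_on k S (\<lambda>x. h x *\<^sub>R frechet_derivative f (at x) v + frechet_derivative h (at x) v *\<^sub>R f x)" for v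
    using Suc.prems Ck_on_Suc_imp[OF Suc.prems(1)] Ck_on_Suc_imp[OF Suc.prems(2)]
    by (intro Ck_on_add Suc.IH assms(1)) auto
  then have "Ck_on k S (\<lambda>x. frechet_derivative (\<lambda>x. h x *\<^sub>R f x) (at x) v)" for v
    by (rule Ck_on_cong[OF assms(1), rotated]) (simp add: frechet_derivative_at[OF D, symmetric])
  then show ?case using D by (auto simp: differentiable_def)
qed

lemma Ck_on_const: "open S \<Longrightarrow> Ck_on k S (\<lambda>x. a)"
  by (induction k arbitrary: a) auto

lemma Ck_on_fst:
  fixes f :: "'a::real_normed_vector \<Rightarrow> 'b::real_normed_vector"
  assumes "Ck_on k S f" "open S"
  shows "Ck_on k (S \<times> (UNIV :: 'c::real_normed_vector set)) (\<lambda>z. f (fst z))"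
  using assms(1)
proof (induction k arbitrary: f)
  case 0
  then show ?case by (auto intro!: continuous_on_compose2[OF _ continuous_on_fst[OF continuous_on_id]])
next
  case (Suc k)
  have D: "((\<lambda>z. f (fst z)) has_derivative (\<lambda>v. frechet_derivative f (at (fst z)) (fst v))) (at z)"
    if "z \<in> S \<times> UNIV" for z
    using Suc.prems that
    by (intro has_derivative_compose[OF has_derivative_fst[OF has_derivative_ident]])
      (auto simp: frechet_derivative_works[symmetric])
  have "Ck_on k (S \<times> (UNIV :: 'c set)) (\<lambda>z. frechet_derivative f (at (fst z)) (fst v))" for v :: "'a \<times> 'c"
    using Suc.IH[of "\<lambda>x. frechet_derivative f (at x) (fst v)"] Suc.prems by simp
  then have "Ck_on k (S \<times> (UNIV :: 'c set)) (\<lambda>z. frechet_derivative (\<lambda>z. f (fst z)) (at z) v)" for v :: "'a \<times> 'c"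
    by (rule Ck_on_cong[rotated 2]) (auto simp: frechet_derivative_at[OF D, symmetric] open_Times assms(2))
  then show ?case unfolding Ck_on.simps differentiable_def using D by blast
qed

lemma Ck_on_snd:
  fixes f :: "'a::real_normed_vector \<Rightarrow> 'b::real_normed_vector"
  assumes "Ck_on k S f" "open S"
  shows "Ck_on k ((UNIV :: 'c::real_normed_vector set) \<times> S) (\<lambda>z. f (snd z))"
  using assms(1)
proof (induction k arbitrary: f)
  case 0
  then show ?case by (auto intro!: continuous_on_compose2[OF _ continuous_on_snd[OF continuous_on_id]])
next
  case (Suc k)
  have D: "((\<lambda>z. f (snd z)) has_derivative (\<lambda>v. frechet_derivative f (at (snd z)) (snd v))) (at z)"
    if "z \<in> UNIV \<times> S" for z
    using Suc.prems that
    by (intro has_derivative_compose[OF has_derivative_snd[OF has_derivative_ident]])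
      (auto simp: frechet_derivative_works[symmetric])
  have "Ck_on k ((UNIV :: 'c set) \<times> S) (\<lambda>z. frechet_derivative f (at (snd z)) (snd v))" for v :: "'c \<times> 'a"
    using Suc.IH[of "\<lambda>x. frechet_derivative f (at x) (snd v)"] Suc.prems by simp
  then have "Ck_on k ((UNIV :: 'c set) \<times> S) (\<lambda>z. frechet_derivative (\<lambda>z. f (snd z)) (at z) v)" for v :: "'c \<times> 'a"
    by (rule Ck_on_cong[rotated 2]) (auto simp: frechet_derivative_at[OF D, symmetric] open_Times assms(2))
  then show ?case unfolding Ck_on.simps differentiable_def using D by blast
qed

lemma Ck_on_subset: "Ck_on k S f \<Longrightarrow> T \<subseteq> S \<Longrightarrow> Ck_on k T f"
  by (induction k arbitrary: f) (auto intro: continuous_on_subset)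

text \<open>The derivative is again of the form \<open>C * (a - b * t) powr p\<close>, with different \<open>C\<close> and \<open>p\<close>; hence
  the induction over all \<open>C\<close> and \<open>p\<close> at once.\<close>

lemma Ck_on_affine_powr:
  fixes a b p C :: real
  shows "Ck_on k {t. 0 < a - b * t} (\<lambda>t. C * (a - b * t) powr p)"
proof (induction k arbitrary: C p)
  case 0
  then show ?case by (auto intro!: continuous_intros)
next
  case (Suc k)
  have op: "open {t. 0 < a - b * t}"
    by (intro open_Collect_less continuous_intros)
  have D: "((\<lambda>t. C * (a - b * t) powr p) has_derivative
      (\<lambda>v. (v * - (C * p * b)) * (a - b * t) powr (p - 1))) (at t)" if "t \<in> {t. 0 < a - b * t}" for t
    using that
    by (auto intro!: derivative_eq_intros simp: fun_eq_iff powr_diff field_simps)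
  have "Ck_on k {t. 0 < a - b * t}
      (\<lambda>t. frechet_derivative (\<lambda>t. C * (a - b * t) powr p) (at t) v)" for v
    by (rule Ck_on_cong[OF op _ Suc.IH[of "v * - (C * p * b)" "p - 1"]])
      (simp add: frechet_derivative_at[OF D, symmetric])
  then show ?case using D by (auto simp: differentiable_def)
qed

text \<open>Solutions of \<open>f'' = l f\<close> are smooth without any composition rules: the pair \<open>(v f', v l f)\<close>
  satisfies the hypotheses whenever the pair \<open>(f, f')\<close> does.\<close>

lemma Ck_on_harmonic:
  fixes f f' :: "real \<Rightarrow> 'b::real_normed_vector"
  assumes "\<And>t. (f has_vector_derivative f' t) (at t)"
    and "\<And>t. (f' has_vector_derivative l *\<^sub>R f t) (at t)"
  shows "Ck_on k UNIV f"
  using assms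
proof (induction k arbitrary: f f')
  case 0
  then show ?case
    by (auto intro!: continuous_at_imp_continuous_on has_vector_derivative_continuous)
next
  case (Suc k)
  have fd: "frechet_derivative f (at t) v = v *\<^sub>R f' t" for t v
    using Suc.prems(1)[of t] unfolding has_vector_derivative_def
    by (metis frechet_derivative_at)
  have "Ck_on k UNIV (\<lambda>t. v *\<^sub>R f' t)" for v
  proof (rule Suc.IH)
    show "((\<lambda>t. v *\<^sub>R f' t) has_vector_derivative v *\<^sub>R l *\<^sub>R f t) (at t)" for t
      using bounded_linear.has_vector_derivative[OF bounded_linear_scaleR_right Suc.prems(2)] .
    show "((\<lambda>t. v *\<^sub>R l *\<^sub>R f t) has_vector_derivative l *\<^sub>R v *\<^sub>R f' t) (at t)" for t
      using bounded_linear.has_vector_derivative[OF bounded_linear_scaleR_right Suc.prems(1), of "v * l"]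
      by (simp add: mult.commute)
  qed
  moreover have "f differentiable (at t)" for t
    using Suc.prems(1) by (auto simp: has_vector_derivative_def differentiable_def)
  ultimately show ?case by (simp add: fd)
qed

lemma smooth_on_open_differentiable:
  assumes "smooth_on S f" "open S" "x \<in> S"
  shows "f differentiable (at x)"
    and "(\<lambda>y. frechet_derivative f (at y) v) differentiable (at x)"
proof -
  obtain W g where W: "open W" "x \<in> W" "\<And>k. Ck_on k W g" "\<And>y. y \<in> W \<inter> S \<Longrightarrow> g y = f y"
    using assms(1,3) unfolding smooth_on_def by metis
  have g2: "Ck_on (Suc (Suc 0)) W g" by (rule W(3))
  have o: "open (W \<inter> S)" "x \<in> W \<inter> S" using assms W by auto
  show "f differentiable (at x)"
    using differentiable_cong_open[OF o, of g f] W(2,4) g2 by auto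
  show "(\<lambda>y. frechet_derivative f (at y) v) differentiable (at x)"
  proof (rule differentiable_cong_open[OF o, of "\<lambda>y. frechet_derivative g (at y) v"])
    show "frechet_derivative g (at y) v = frechet_derivative f (at y) v" if "y \<in> W \<inter> S" for y
      using frechet_derivative_cong_open[OF o(1) that W(4)] by simp
    show "(\<lambda>y. frechet_derivative g (at y) v) differentiable (at x)"
      using g2 W(2) by simp
  qed
qed

lemma smooth_on_scaleR_const:
  assumes "smooth_on S f"
  shows "smooth_on S (\<lambda>x. s *\<^sub>R f x)"
  unfolding smooth_on_def
proof
  fix x assume "x \<in> S"
  then obtain W g where W: "open W" "x \<in> W" "\<And>k. Ck_on k W g" "\<And>y. y \<in> W \<inter> S \<Longrightarrow> g y = f y"
    using assms unfolding smooth_on_def by metis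
  then show "\<exists>W g. open W \<and> x \<in> W \<and> (\<forall>k. Ck_on k W g) \<and> (\<forall>y\<in>W \<inter> S. g y = s *\<^sub>R f y)"
    by (intro exI[of _ W] exI[of _ "\<lambda>x. s *\<^sub>R g x"]) (auto intro!: Ck_on_scaleR Ck_on_const)
qed

text \<open>This is the form of a homothetic flow in a chart. The time interval \<open>I\<close> is half-open, and the
  open set \<open>J\<close> provides the extension beyond its closed end.\<close>

lemma smooth_on_separated_product:
  fixes h :: "real \<Rightarrow> real"
  assumes "smooth_on S f" "open J" "\<And>k. Ck_on k J h" "I \<subseteq> J"
  shows "smooth_on (S \<times> I) (\<lambda>(x, t). h t *\<^sub>R f x)"
  unfolding smooth_on_def
proof
  fix z assume z: "z \<in> S \<times> I"
  then obtain W g where W: "open W" "fst z \<in> W" "\<And>k. Ck_on k W g" "\<And>y. y \<in> W \<inter> S \<Longrightarrow> g y = f y"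
    using assms(1) unfolding smooth_on_def by (metis mem_Times_iff)
  have "Ck_on k (W \<times> J) (\<lambda>z. h (snd z) *\<^sub>R g (fst z))" for k
    by (intro Ck_on_scaleR open_Times W(1) assms(2)
      Ck_on_subset[OF Ck_on_fst[OF W(3,1)]] Ck_on_subset[OF Ck_on_snd[OF assms(3,2)]]) auto
  then show "\<exists>V g. open V \<and> z \<in> V \<and> (\<forall>k. Ck_on k V g) \<and>
      (\<forall>y\<in>V \<inter> (S \<times> I). g y = (case y of (x, t) \<Rightarrow> h t *\<^sub>R f x))"
    using z W assms
    by (intro exI[of _ "W \<times> J"] exI[of _ "\<lambda>z. h (snd z) *\<^sub>R g (fst z)"]) (auto simp: open_Times)
qed


section \<open>Orthogonal projections and tangent spaces in pseudo-Euclidean space\<close>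

locale pseudo_euclidean =
  fixes B :: "real ^ 'n \<Rightarrow> real ^ 'n \<Rightarrow> real"
  assumes nondegenerate_form: "nondegenerate_form B"
begin

sublocale form: bounded_bilinear B
  using nondegenerate_form by (simp add: nondegenerate_form_def bilinear_conv_bounded_bilinear)

lemma form_commute: "B v w = B w v"
  using nondegenerate_form unfolding nondegenerate_form_def by blast

lemma form_eq_zeroD: "(\<And>w. B v w = 0) \<Longrightarrow> v = 0"
  using nondegenerate_form unfolding nondegenerate_form_def by blast

lemmas form_simps = form.add_left form.add_right form.diff_left form.diff_right
  form.scaleR_left form.scaleR_right form.sum_left form.sum_right form.zero_left form.zero_right

text \<open>The second assumption says that the form is nondegenerate on \<open>V\<close>, which makes the projection
  unique.\<close>

lemma orth_proj_eqI:
  assumes "subspace V" and "\<And>d. d \<in> V \<Longrightarrow> (\<And>w. w \<in> V \<Longrightarrow> B d w = 0) \<Longrightarrow> d = 0"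
    and "u \<in> V" and "\<And>w. w \<in> V \<Longrightarrow> B (v - u) w = 0"
  shows "orth_proj B V v = u"
  unfolding orth_proj_def
proof (rule the_equality)
  show "u \<in> V \<and> (\<forall>w\<in>V. B (v - u) w = 0)" using assms by blast
  fix u' assume u': "u' \<in> V \<and> (\<forall>w\<in>V. B (v - u') w = 0)"
  have "B (u' - u) w = 0" if "w \<in> V" for w
    using u' assms(4)[OF that] that by (simp add: form_simps)
  then have "u' - u = 0"
    using assms(1,3) u' by (intro assms(2) subspace_diff) auto
  then show "u' = u" by simp
qed

lemma orth_proj_UNIV: "orth_proj B UNIV v = v"
  by (rule orth_proj_eqI) (auto intro: form_eq_zeroD simp: form_simps)

end

lemma harmonic_velocity_in_tangent_space:
  assumes "\<And>t. (\<gamma> has_vector_derivative \<gamma>' t) (at t)"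
    and "\<And>t. (\<gamma>' has_vector_derivative l *\<^sub>R \<gamma> t) (at t)" and "\<And>t. \<gamma> t \<in> N"
  shows "\<gamma>' 0 \<in> tangent_space N (\<gamma> 0)"
proof -
  have "smooth_on {-1<..<1} \<gamma>"
    unfolding smooth_on_def using Ck_on_harmonic[OF assms(1,2)]
    by (intro ballI exI[of _ UNIV] exI[of _ \<gamma>]) auto
  then show ?thesis
    unfolding tangent_space_def using assms
    by (auto intro!: exI[of _ \<gamma>] exI[of _ "1::real"])
qed

lemma tangent_space_UNIV: "tangent_space UNIV y = UNIV"
proof -
  have "v \<in> tangent_space UNIV y" for v
  proof -
    have "((\<lambda>t. y + t *\<^sub>R v) has_vector_derivative v) (at t)" for t
      by (auto intro!: derivative_eq_intros)
    then show ?thesis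
      using harmonic_velocity_in_tangent_space[of "\<lambda>t. y + t *\<^sub>R v" "\<lambda>t. v" 0 UNIV] by simp
  qed
  then show ?thesis by auto
qed

text \<open>The solutions of \<open>C'' = - q C\<close> and \<open>S'' = - q S\<close> with the initial values of cosine and sine:
  trigonometric, affine or hyperbolic according to the sign of \<open>q\<close>. They give curves in the
  plane sections of a hyperquadric of any signature.\<close>

lemma ex_generalized_cos_sin:
  fixes q :: real
  shows "\<exists>C S. (\<forall>t. (C has_real_derivative - q * S t) (at t)) \<and> (\<forall>t. (S has_real_derivative C t) (at t))
    \<and> (\<forall>t. (C t)\<^sup>2 + q * (S t)\<^sup>2 = 1) \<and> C 0 = 1 \<and> S 0 = 0"
proof -
  consider "q = 0" | "q > 0" | "q < 0" by linarith
  then show ?thesis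
  proof cases
    case 1
    then show ?thesis
      by (intro exI[of _ "\<lambda>t. 1"] exI[of _ "\<lambda>t. t"]) (auto intro!: derivative_eq_intros)
  next
    case 2
    define w where "w = sqrt q"
    have w: "w > 0" "q = w\<^sup>2" using 2 by (auto simp: w_def)
    show ?thesis
      using w by (intro exI[of _ "\<lambda>t. cos (w * t)"] exI[of _ "\<lambda>t. sin (w * t) / w"])
        (auto intro!: derivative_eq_intros simp: power2_eq_square field_simps sin_squared_eq[unfolded power2_eq_square])
  next
    case 3
    define w where "w = sqrt (-q)"
    have w: "w > 0" "q = - w\<^sup>2" using 3 by (auto simp: w_def)
    show ?thesis
      using w by (intro exI[of _ "\<lambda>t. cosh (w * t)"] exI[of _ "\<lambda>t. sinh (w * t) / w"])
        (auto intro!: derivative_eq_intros simp: power_divide cosh_square_eq, auto simp: power2_eq_square field_simps)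
  qed
qed

context pseudo_euclidean
begin

text \<open>A vector \<open>v\<close> orthogonal to \<open>y\<close> is the velocity of the curve \<open>C(t) y + S(t) v\<close>. Its squared norm
  is \<open>k (C\<^sup>2 + q S\<^sup>2)\<close> with \<open>q = \<langle>v, v\<rangle> / k\<close>, hence constant for the generalised cosine and sine
  with this \<open>q\<close>; the curve exists for spacelike, lightlike and timelike \<open>v\<close> alike.\<close>

lemma tangent_space_hyperquadric:
  assumes "k > 0" and y: "B y y = k"
  shows "tangent_space (hyperquadric B k) y = {v. B y v = 0}"
proof (intro equalityI subsetI CollectI)
  fix v assume "v \<in> tangent_space (hyperquadric B k) y"
  then obtain \<gamma> e where g: "e > 0" "\<gamma> ` {-e<..<e} \<subseteq> hyperquadric B k" "\<gamma> 0 = y"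
      "(\<gamma> has_vector_derivative v) (at (0::real))"
    unfolding tangent_space_def by blast
  have "((\<lambda>t. B (\<gamma> t) (\<gamma> t)) has_vector_derivative B y v + B v y) (at 0)"
    using form.has_vector_derivative[OF g(4,4)] g(3) by simp
  then have "((\<lambda>t. k) has_vector_derivative B y v + B v y) (at 0)"
    by (rule has_vector_derivative_transform_within_open[where S = "{-e<..<e}"])
      (use g(1,2) in \<open>auto simp: hyperquadric_def image_subset_iff\<close>)
  then have "B y v + B v y = 0"
    using vector_derivative_unique_at has_vector_derivative_const by blast
  then show "B y v = 0" using form_commute[of v y] by simp
next
  fix v assume "v \<in> {v. B y v = 0}"
  then have v: "B y v = 0" "B v y = 0" using form_commute[of v y] by auto
  define q where "q = B v v / k"
  obtain C S where CS: "\<And>t. (C has_real_derivative - q * S t) (at t)"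
      "\<And>t. (S has_real_derivative C t) (at t)" "\<And>t. (C t)\<^sup>2 + q * (S t)\<^sup>2 = 1" "C 0 = 1" "S 0 = 0"
    using ex_generalized_cos_sin[of q] by blast
  define \<gamma> where "\<gamma> t = C t *\<^sub>R y + S t *\<^sub>R v" for t
  have "\<gamma> t \<in> hyperquadric B k" for t
  proof -
    have "B (\<gamma> t) (\<gamma> t) = k * ((C t)\<^sup>2 + q * (S t)\<^sup>2)"
      using assms v by (simp add: \<gamma>_def form_simps q_def power2_eq_square field_simps)
    then show ?thesis by (simp add: CS hyperquadric_def)
  qed
  then have "(- q * S 0) *\<^sub>R y + C 0 *\<^sub>R v \<in> tangent_space (hyperquadric B k) (\<gamma> 0)"
    by (intro harmonic_velocity_in_tangent_space[where \<gamma>' = "\<lambda>t. (- q * S t) *\<^sub>R y + C t *\<^sub>R v" and l = "- q"])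
      (auto simp: \<gamma>_def algebra_simps intro!: derivative_eq_intros CS)
  then show "v \<in> tangent_space (hyperquadric B k) y"
    by (simp add: \<gamma>_def CS)
qed

lemma orth_proj_tangent_space_hyperquadric:
  assumes "k > 0" and y: "B y y = k"
  shows "orth_proj B (tangent_space (hyperquadric B k) y) v = v - (B v y / k) *\<^sub>R y"
  unfolding tangent_space_hyperquadric[OF assms]
proof (rule orth_proj_eqI)
  show "subspace {v. B y v = 0}"
    by (auto simp: subspace_def form_simps)
  show "v - (B v y / k) *\<^sub>R y \<in> {v. B y v = 0}"
    using assms by (simp add: form_simps form_commute)
  show "B (v - (v - (B v y / k) *\<^sub>R y)) w = 0" if "w \<in> {v. B y v = 0}" for w
    using that by (simp add: form_simps)
  fix d assume d: "d \<in> {v. B y v = 0}" "\<And>w. w \<in> {v. B y v = 0} \<Longrightarrow> B d w = 0"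
  have "B d w = 0" for w
  proof -
    \<comment> \<open>The correction makes the test vector tangent, and does not change the value since \<open>d\<close> is orthogonal to \<open>y\<close>.\<close>
    have "B d (w - (B y w / k) *\<^sub>R y) = 0"
      using assms by (intro d(2)) (simp add: form_simps)
    then show ?thesis using d(1) form_commute[of d y] by (simp add: form_simps)
  qed
  then show "d = 0" by (rule form_eq_zeroD)
qed

end

section \<open>Second fundamental tensor in a chart\<close>

lemma matrix_inv_eqI:
  fixes A A' :: "real ^ 'n ^ 'n"
  assumes "A ** A' = mat 1" and "A' ** A = mat 1"
  shows "matrix_inv A = A'"
  unfolding matrix_inv_def
proof (rule some_equality)
  fix C assume "A ** C = mat 1 \<and> C ** A = mat 1"
  then have "A' ** (A ** C) = A'" by simp
  then show "C = A'"
    using assms by (simp add: matrix_mul_assoc)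
qed (use assms in blast)

locale nondegenerate_chart = pseudo_euclidean B for B :: "real ^ 'n \<Rightarrow> real ^ 'n \<Rightarrow> real" +
  fixes F :: "'a \<Rightarrow> real ^ 'n" and c :: "('a, 'm::finite) chart" and x :: "real ^ 'm"
  assumes open_chart_image: "open (chart_image c)" and point_in_chart: "x \<in> chart_image c"
    and smooth_local_rep: "smooth_on (chart_image c) (local_rep F c)"
    and differential_nondegenerate:
      "(\<And>w. B (frechet_derivative (local_rep F c) (at x) v)
              (frechet_derivative (local_rep F c) (at x) w) = 0) \<Longrightarrow> v = 0"
begin

abbreviation e :: "'m \<Rightarrow> real ^ 'n" where "e i \<equiv> pd i (local_rep F c) x"
abbreviation h :: "'m \<Rightarrow> 'm \<Rightarrow> real ^ 'n" where "h i j \<equiv> pd i (pd j (local_rep F c)) x"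
abbreviation G :: "real ^ 'm ^ 'm" where "G \<equiv> induced_metric B F c x"

lemmas local_rep_differentiable = smooth_on_open_differentiable(1)[OF smooth_local_rep open_chart_image]

lemma differential_eq_sum: "frechet_derivative (local_rep F c) (at x) v = (\<Sum>i\<in>UNIV. (v $ i) *\<^sub>R e i)"
proof -
  interpret linear "frechet_derivative (local_rep F c) (at x)"
    by (rule linear_frechet_derivative[OF local_rep_differentiable[OF point_in_chart]])
  have "v = (\<Sum>i\<in>UNIV. (v $ i) *\<^sub>R axis i 1)"
    using basis_expansion[of v] by (simp add: scalar_mult_eq_scaleR)
  then show ?thesis
    unfolding pd_def by (metis (no_types, lifting) scaleR sum sum.cong)
qed

lemma metric_nth: "G $ i $ j = B (e i) (e j)"
  by (simp add: induced_metric_def)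

lemma metric_symmetric: "G $ i $ j = G $ j $ i"
  unfolding metric_nth by (rule form_commute)

lemma metric_invertible: "invertible G"
  unfolding invertible_left_inverse matrix_left_invertible_ker
proof (intro allI impI)
  fix v assume v: "G *v v = 0"
  have "B (e i) (frechet_derivative (local_rep F c) (at x) v) = 0" for i
  proof -
    have "(G *v v) $ i = 0" using v by simp
    then show ?thesis
      by (simp add: matrix_vector_mult_def metric_nth differential_eq_sum form_simps mult.commute)
  qed
  then have "B (frechet_derivative (local_rep F c) (at x) v) (frechet_derivative (local_rep F c) (at x) w) = 0" for w
    by (subst form_commute, subst differential_eq_sum) (simp add: form_simps)
  then show "v = 0" by (rule differential_nondegenerate)
qed

lemma metric_inverse:
  shows "G ** matrix_inv G = mat 1" and "matrix_inv G ** G = mat 1"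
  using metric_invertible unfolding invertible_def matrix_inv_def by (metis (mono_tags, lifting) someI_ex)+

text \<open>The contraction of the metric with its inverse is the dimension; this is the source of the factor
  \<open>m\<close> in the flow.\<close>

lemma trace_metric_inverse:
  "(\<Sum>i\<in>UNIV. \<Sum>j\<in>UNIV. matrix_inv G $ i $ j * G $ i $ j) = real CARD('m)"
proof -
  have "(\<Sum>j\<in>UNIV. matrix_inv G $ i $ j * G $ i $ j) = 1" for i
  proof -
    have "(\<Sum>j\<in>UNIV. matrix_inv G $ i $ j * G $ i $ j) = (matrix_inv G ** G) $ i $ i"
      by (simp add: matrix_matrix_mult_def metric_symmetric[of i])
    then show ?thesis by (simp add: metric_inverse mat_def)
  qed
  then show ?thesis by simp
qed

text \<open>The orthogonal projection onto the tangent space, as an explicit linear map: the coefficients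
  of \<open>v\<close> against the coordinate vectors are raised with the inverse metric.\<close>

definition tangential_part :: "real ^ 'n \<Rightarrow> real ^ 'n" where
  "tangential_part v = (\<Sum>i\<in>UNIV. \<Sum>j\<in>UNIV. (matrix_inv G $ i $ j * B v (e j)) *\<^sub>R e i)"

lemma form_tangential_part: "B (tangential_part v) (e l) = B v (e l)"
proof -
  have "B (tangential_part v) (e l) = (\<Sum>i\<in>UNIV. \<Sum>j\<in>UNIV. B v (e j) * (G $ l $ i * matrix_inv G $ i $ j))"
    by (simp add: tangential_part_def form_simps metric_nth form_commute[of "e l"] algebra_simps)
  also have "\<dots> = (\<Sum>j\<in>UNIV. B v (e j) * (G ** matrix_inv G) $ l $ j)"
    by (subst sum.swap) (simp add: matrix_matrix_mult_def sum_distrib_left)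
  also have "\<dots> = B v (e l)"
    by (simp add: metric_inverse mat_def if_distrib cong: if_cong)
  finally show ?thesis .
qed

lemma form_tangential_part_eq_zero: "(\<And>i. B w (e i) = 0) \<Longrightarrow> B w (tangential_part v) = 0"
  by (simp add: tangential_part_def form_simps)

lemma tangential_part_eq_zero: "(\<And>i. B w (e i) = 0) \<Longrightarrow> tangential_part w = 0"
  by (simp add: tangential_part_def)

lemma tangential_part_diff: "tangential_part (v - w) = tangential_part v - tangential_part w"
  by (simp add: tangential_part_def form_simps algebra_simps sum_subtractf)

lemma tangential_part_scaleR: "tangential_part (s *\<^sub>R v) = s *\<^sub>R tangential_part v"
  by (simp add: tangential_part_def form_simps scaleR_sum_right ac_simps)

lemma normal_space_eq:
  "normal_space B N F c x = {w \<in> tangent_space N (local_rep F c x). \<forall>i. B w (e i) = 0}"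
proof -
  have "(\<forall>v. B w (frechet_derivative (local_rep F c) (at x) v) = 0) \<longleftrightarrow> (\<forall>i. B w (e i) = 0)" for w
  proof
    show "\<forall>i. B w (e i) = 0" if "\<forall>v. B w (frechet_derivative (local_rep F c) (at x) v) = 0"
      using that by (simp add: pd_def)
    show "\<forall>v. B w (frechet_derivative (local_rep F c) (at x) v) = 0" if "\<forall>i. B w (e i) = 0"
      using that by (simp add: differential_eq_sum form_simps)
  qed
  then show ?thesis by (simp add: normal_space_def)
qed

lemma orth_proj_normal_space_UNIV:
  "orth_proj B (normal_space B UNIV F c x) v = v - tangential_part v"
proof (rule orth_proj_eqI)
  let ?V = "normal_space B UNIV F c x"
  have V: "?V = {w. \<forall>i. B w (e i) = 0}"
    by (simp add: normal_space_eq tangent_space_UNIV)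
  show "subspace ?V" by (auto simp: V subspace_def form_simps)
  show "v - tangential_part v \<in> ?V" for v
    by (simp add: V form_simps form_tangential_part)
  then have *: "w - tangential_part w \<in> ?V" for w .
  show "B (v - (v - tangential_part v)) w = 0" if "w \<in> ?V" for w
    using that form_tangential_part_eq_zero[of w v] form_commute[of w] by (simp add: V)
  fix d assume d: "d \<in> ?V" "\<And>w. w \<in> ?V \<Longrightarrow> B d w = 0"
  have "B d w = 0" for w
    using d(2)[OF *[of w]] form_tangential_part_eq_zero[of d w] d(1) by (simp add: V form_simps)
  then show "d = 0" by (rule form_eq_zeroD)
qed

lemma second_fundamental_UNIV:
  "second_fundamental B UNIV F c x i j = h i j - tangential_part (h i j)"
  by (simp add: second_fundamental_def tangent_space_UNIV orth_proj_UNIV orth_proj_normal_space_UNIV)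

lemma nondegenerate_chart_scaleR:
  assumes "s \<noteq> 0"
  shows "nondegenerate_chart B (\<lambda>p. s *\<^sub>R F p) c x"
proof
  have eq: "local_rep (\<lambda>p. s *\<^sub>R F p) c = (\<lambda>z. s *\<^sub>R local_rep F c z)" by (simp add: o_def)
  show "smooth_on (chart_image c) (local_rep (\<lambda>p. s *\<^sub>R F p) c)"
    unfolding eq by (rule smooth_on_scaleR_const[OF smooth_local_rep])
  show "v = 0" if "\<And>w. B (frechet_derivative (local_rep (\<lambda>p. s *\<^sub>R F p) c) (at x) v)
              (frechet_derivative (local_rep (\<lambda>p. s *\<^sub>R F p) c) (at x) w) = 0" for v
    using that assms unfolding eq frechet_derivative_scaleR[OF local_rep_differentiable[OF point_in_chart]]
    by (intro differential_nondegenerate) (auto simp: form_simps)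
qed (fact open_chart_image point_in_chart)+

lemma pd_local_rep_scaleR:
  assumes "z \<in> chart_image c"
  shows "pd i (local_rep (\<lambda>p. s *\<^sub>R F p) c) z = s *\<^sub>R pd i (local_rep F c) z"
proof -
  have eq: "local_rep (\<lambda>p. s *\<^sub>R F p) c = (\<lambda>z. s *\<^sub>R local_rep F c z)" by (simp add: o_def)
  show ?thesis
    unfolding eq pd_def frechet_derivative_scaleR[OF local_rep_differentiable[OF assms]] by simp
qed

lemma pd_differentiable: "pd j (local_rep F c) differentiable (at x)"
  using smooth_on_open_differentiable(2)[OF smooth_local_rep open_chart_image point_in_chart, of "axis j 1"]
  by (simp add: pd_def[abs_def])

lemma pd_pd_local_rep_scaleR:
  "pd i (pd j (local_rep (\<lambda>p. s *\<^sub>R F p) c)) x = s *\<^sub>R h i j"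
proof -
  have "pd i (pd j (local_rep (\<lambda>p. s *\<^sub>R F p) c)) x = pd i (\<lambda>z. s *\<^sub>R pd j (local_rep F c) z) x"
    using open_chart_image point_in_chart by (rule pd_cong_open) (rule pd_local_rep_scaleR)
  then show ?thesis
    by (simp add: pd_def[of i] frechet_derivative_scaleR[OF pd_differentiable])
qed

lemma normal_space_UNIV_scaleR:
  assumes "s \<noteq> 0"
  shows "normal_space B UNIV (\<lambda>p. s *\<^sub>R F p) c x = normal_space B UNIV F c x"
proof -
  interpret scaled: nondegenerate_chart B "\<lambda>p. s *\<^sub>R F p" c x
    by (rule nondegenerate_chart_scaleR[OF assms])
  show ?thesis
    using assms
    by (simp add: normal_space_eq scaled.normal_space_eq tangent_space_UNIV
      pd_local_rep_scaleR[OF point_in_chart] form_simps)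
qed

lemma second_fundamental_UNIV_scaleR:
  assumes "s \<noteq> 0"
  shows "second_fundamental B UNIV (\<lambda>p. s *\<^sub>R F p) c x i j = s *\<^sub>R second_fundamental B UNIV F c x i j"
  by (simp add: second_fundamental_def tangent_space_UNIV orth_proj_UNIV pd_pd_local_rep_scaleR
    normal_space_UNIV_scaleR[OF assms] orth_proj_normal_space_UNIV tangential_part_scaleR scaleR_diff_right)

lemma matrix_inv_metric_scaleR:
  assumes "s \<noteq> 0"
  shows "matrix_inv (induced_metric B (\<lambda>p. s *\<^sub>R F p) c x) = (1 / s\<^sup>2) *\<^sub>R matrix_inv G"
proof -
  have eq: "induced_metric B (\<lambda>p. s *\<^sub>R F p) c x = s\<^sup>2 *\<^sub>R G"
    by (simp add: induced_metric_def pd_local_rep_scaleR[OF point_in_chart] form_simps vec_eq_iff power2_eq_square)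
  show ?thesis
    unfolding eq using assms
    by (intro matrix_inv_eqI) (simp_all add: matrix_scalar_ac scalar_matrix_assoc metric_inverse)
qed

text \<open>The second fundamental tensor scales like the map, the inverse metric by the inverse square of
  the factor, so their contraction scales inversely.\<close>

lemma trace_second_fundamental_scaleR:
  assumes "s \<noteq> 0"
  shows "(\<Sum>i\<in>UNIV. \<Sum>j\<in>UNIV. matrix_inv (induced_metric B (\<lambda>p. s *\<^sub>R F p) c x) $ i $ j *\<^sub>R
      second_fundamental B UNIV (\<lambda>p. s *\<^sub>R F p) c x i j) =
    (1 / s) *\<^sub>R (\<Sum>i\<in>UNIV. \<Sum>j\<in>UNIV. matrix_inv G $ i $ j *\<^sub>R second_fundamental B UNIV F c x i j)"
  using assms
  by (simp add: matrix_inv_metric_scaleR second_fundamental_UNIV_scaleR scaleR_sum_right power2_eq_square)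

context
  fixes k :: real
  assumes k_pos: "k > 0"
    and in_hyperquadric: "\<And>z. z \<in> chart_image c \<Longrightarrow> B (local_rep F c z) (local_rep F c z) = k"
begin

text \<open>The derivative of \<open>\<langle>F, F\<rangle> = k\<close>.\<close>

lemma position_normal:
  assumes "z \<in> chart_image c"
  shows "B (local_rep F c z) (pd i (local_rep F c) z) = 0"
proof -
  let ?f = "local_rep F c" and ?D = "frechet_derivative (local_rep F c) (at z)"
  have "(?f has_derivative ?D) (at z)"
    using local_rep_differentiable[OF assms] by (simp add: frechet_derivative_works)
  from form.FDERIV[OF this this]
  have "((\<lambda>z. B (?f z) (?f z)) has_derivative (\<lambda>v. B (?f z) (?D v) + B (?D v) (?f z))) (at z)" .
  then have "((\<lambda>z. k) has_derivative (\<lambda>v. B (?f z) (?D v) + B (?D v) (?f z))) (at z)"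
    by (rule has_derivative_transform_within_open[OF _ open_chart_image assms]) (rule in_hyperquadric)
  then have "(\<lambda>v. B (?f z) (?D v) + B (?D v) (?f z)) = (\<lambda>v. 0)"
    using has_derivative_unique has_derivative_const by blast
  then have "B (?f z) (?D v) + B (?D v) (?f z) = 0" for v by meson
  then show ?thesis
    using form_commute[of "?f z"] by (simp add: pd_def)
qed

text \<open>The \<open>i\<close>-th derivative of \<open>\<langle>F, \<partial>\<^sub>jF\<rangle> = 0\<close>.\<close>

lemma form_second_derivative_position: "B (h i j) (local_rep F c x) = - G $ i $ j"
proof -
  let ?f = "local_rep F c" and ?D = "frechet_derivative (local_rep F c) (at x)"
    and ?D2 = "frechet_derivative (pd j (local_rep F c)) (at x)"
  have "(?f has_derivative ?D) (at x)" "(pd j ?f has_derivative ?D2) (at x)"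
    using local_rep_differentiable[OF point_in_chart] pd_differentiable
    by (simp_all add: frechet_derivative_works)
  from form.FDERIV[OF this]
  have "((\<lambda>z. B (?f z) (pd j ?f z)) has_derivative (\<lambda>v. B (?f x) (?D2 v) + B (?D v) (pd j ?f x))) (at x)" .
  then have "((\<lambda>z. 0) has_derivative (\<lambda>v. B (?f x) (?D2 v) + B (?D v) (pd j ?f x))) (at x)"
    by (rule has_derivative_transform_within_open[OF _ open_chart_image point_in_chart]) (rule position_normal)
  then have "(\<lambda>v. B (?f x) (?D2 v) + B (?D v) (pd j ?f x)) = (\<lambda>v. 0)"
    using has_derivative_unique has_derivative_const by blast
  then have "B (?f x) (?D2 v) + B (?D v) (pd j ?f x) = 0" for v by meson
  from this[of "axis i 1"] have "B (?f x) (h i j) + B (e i) (e j) = 0"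
    by (simp add: pd_def)
  then show ?thesis
    using form_commute[of "?f x" "h i j"] by (simp add: metric_nth)
qed

lemma position_is_normal_part:
  "orth_proj B (normal_space B UNIV F c x) (local_rep F c x) = local_rep F c x"
  using position_normal[OF point_in_chart]
  by (simp add: orth_proj_normal_space_UNIV tangential_part_eq_zero)

lemma normal_space_hyperquadric:
  "normal_space B (hyperquadric B k) F c x = {w. B (local_rep F c x) w = 0 \<and> (\<forall>i. B w (e i) = 0)}"
  unfolding normal_space_eq tangent_space_hyperquadric[OF k_pos in_hyperquadric[OF point_in_chart]] by simp

lemma orth_proj_normal_space_hyperquadric:
  assumes "B (local_rep F c x) v = 0"
  shows "orth_proj B (normal_space B (hyperquadric B k) F c x) v = v - tangential_part v"
  unfolding normal_space_hyperquadric
proof (rule orth_proj_eqI)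
  let ?y = "local_rep F c x"
  let ?V = "{w. B ?y w = 0 \<and> (\<forall>i. B w (e i) = 0)}"
  have y: "B ?y ?y = k" "\<And>i. B ?y (e i) = 0"
    using in_hyperquadric position_normal point_in_chart by auto
  have mem: "w - tangential_part w \<in> ?V" if "B ?y w = 0" for w
    using that form_tangential_part_eq_zero[OF y(2)] by (simp add: form_simps form_tangential_part)
  show "subspace ?V" by (auto simp: subspace_def form_simps)
  show "v - tangential_part v \<in> ?V" by (rule mem[OF assms])
  show "B (v - (v - tangential_part v)) w = 0" if "w \<in> ?V" for w
    using that form_tangential_part_eq_zero[of w v] form_commute[of w] by simp
  fix d assume d: "d \<in> ?V" "\<And>w. w \<in> ?V \<Longrightarrow> B d w = 0"
  have "B d w = 0" for w
  proof -
    let ?w = "w - (B ?y w / k) *\<^sub>R ?y"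
    have "B d (?w - tangential_part ?w) = 0"
      using k_pos y by (intro d(2) mem) (simp add: form_simps)
    then show ?thesis
      using d(1) form_tangential_part_eq_zero[of d ?w] form_commute[of d ?y] by (simp add: form_simps)
  qed
  then show "d = 0" by (rule form_eq_zeroD)
qed

text \<open>Projecting \<open>\<partial>\<^sub>i\<partial>\<^sub>jF\<close> to the hyperquadric first removes its component along the position vector,
  whose coefficient is \<open>- g\<^sub>i\<^sub>j / k\<close>. As the position vector is normal, the tangential part that is
  removed afterwards is the same as in the ambient space.\<close>

lemma second_fundamental_hyperquadric:
  "second_fundamental B (hyperquadric B k) F c x i j =
     second_fundamental B UNIV F c x i j + (G $ i $ j / k) *\<^sub>R local_rep F c x"
proof -
  let ?y = "local_rep F c x"
  have y: "B ?y ?y = k" "\<And>i. B ?y (e i) = 0"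
    using in_hyperquadric position_normal point_in_chart by auto
  let ?u = "h i j - (B (h i j) ?y / k) *\<^sub>R ?y"
  have "second_fundamental B (hyperquadric B k) F c x i j = ?u - tangential_part ?u"
    unfolding second_fundamental_def orth_proj_tangent_space_hyperquadric[OF k_pos y(1)]
    using k_pos y form_commute[of ?y "h i j"]
    by (intro orth_proj_normal_space_hyperquadric) (simp add: form_simps)
  also have "tangential_part ?u = tangential_part (h i j)"
    by (simp add: tangential_part_diff tangential_part_scaleR tangential_part_eq_zero[OF y(2)] del: o_apply)
  finally show ?thesis
    by (simp add: form_second_derivative_position second_fundamental_UNIV del: o_apply)
qed

lemma second_fundamental_hyperquadric_tangent:
  "B (local_rep F c x) (second_fundamental B (hyperquadric B k) F c x i j) = 0"
proof -
  let ?y = "local_rep F c x"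
  have y: "B ?y ?y = k" "\<And>i. B ?y (e i) = 0"
    using in_hyperquadric position_normal point_in_chart by auto
  show ?thesis
    using k_pos form_tangential_part_eq_zero[OF y(2)] form_second_derivative_position[of i j] form_commute[of ?y "h i j"]
    by (simp add: second_fundamental_hyperquadric second_fundamental_UNIV form_simps y del: o_apply)
qed

lemma trace_second_fundamental_hyperquadric:
  "(\<Sum>i\<in>UNIV. \<Sum>j\<in>UNIV. matrix_inv G $ i $ j *\<^sub>R second_fundamental B (hyperquadric B k) F c x i j) =
   (\<Sum>i\<in>UNIV. \<Sum>j\<in>UNIV. matrix_inv G $ i $ j *\<^sub>R second_fundamental B UNIV F c x i j)
     + (real CARD('m) / k) *\<^sub>R local_rep F c x"
proof -
  have "(\<Sum>i\<in>UNIV. \<Sum>j\<in>UNIV. matrix_inv G $ i $ j *\<^sub>R (G $ i $ j / k) *\<^sub>R local_rep F c x) =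
      ((\<Sum>i\<in>UNIV. \<Sum>j\<in>UNIV. matrix_inv G $ i $ j * G $ i $ j) / k) *\<^sub>R local_rep F c x"
    by (simp add: scaleR_sum_left sum_divide_distrib)
  then show ?thesis
    by (simp add: second_fundamental_hyperquadric scaleR_add_right sum.distrib trace_metric_inverse)
qed

end

end


section \<open>Mean curvature of immersed manifolds\<close>

locale nondegenerate_submanifold = pseudo_euclidean B for B :: "real ^ 'n \<Rightarrow> real ^ 'n \<Rightarrow> real" +
  fixes M :: "'a topology" and A :: "('a, 'm::finite) chart set" and F :: "'a \<Rightarrow> real ^ 'n"
  assumes manifold: "smooth_manifold M A" and immersion: "nondegenerate_immersion B A F"
begin

lemma chart_in_atlas: "c \<in> A \<Longrightarrow> is_chart M c"
  using manifold by (auto simp: smooth_manifold_def smooth_atlas_def)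

lemma param_in_topspace:
  assumes "c \<in> A" and "x \<in> chart_image c"
  shows "param c x \<in> topspace M"
  using inv_into_into[OF assms(2)] openin_subset[of M "chart_dom c"] chart_in_atlas[OF assms(1)]
  by (auto simp: is_chart_def)

lemma chart_at_point:
  assumes "p \<in> topspace M"
  shows "chart_at A p \<in> A" and "coord (chart_at A p) p \<in> chart_image (chart_at A p)"
    and "param (chart_at A p) (coord (chart_at A p) p) = p"
proof -
  have "p \<in> (\<Union>c\<in>A. chart_dom c)"
    using assms manifold by (simp add: smooth_manifold_def smooth_atlas_def)
  then have "\<exists>c. c \<in> A \<and> p \<in> chart_dom c" by blast
  then have c: "chart_at A p \<in> A" "p \<in> chart_dom (chart_at A p)"
    unfolding chart_at_def by (metis (mono_tags, lifting) someI_ex)+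
  then show "chart_at A p \<in> A" "coord (chart_at A p) p \<in> chart_image (chart_at A p)" by auto
  have "is_chart M (chart_at A p)" by (rule chart_in_atlas[OF c(1)])
  then have "inj_on (coord (chart_at A p)) (chart_dom (chart_at A p))"
    unfolding is_chart_def
    by (metis homeomorphic_imp_injective_map openin_subset topspace_subtopology_subset)
  then show "param (chart_at A p) (coord (chart_at A p) p) = p"
    using c(2) by simp
qed

lemma nondegenerate_chart:
  assumes "c \<in> A" and "x \<in> chart_image c"
  shows "nondegenerate_chart B F c x"
  using assms chart_in_atlas[OF assms(1)] immersion
  by unfold_locales (auto simp: is_chart_def nondegenerate_immersion_def smooth_immersion_def Let_def)

text \<open>Functions that agree on the manifold may differ at points of the type outside it. Their
  coordinate representations agree on the open chart images, so all derivatives there agree.\<close>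

lemma mean_curvature_cong:
  assumes "p \<in> topspace M" and "\<And>q. q \<in> topspace M \<Longrightarrow> F' q = F q"
  shows "mean_curvature B N A F' p = mean_curvature B N A F p"
proof -
  define c where "c = chart_at A p"
  define x where "x = coord c p"
  have c: "c \<in> A" "x \<in> chart_image c"
    using chart_at_point[OF assms(1)] by (auto simp: c_def x_def)
  have op: "open (chart_image c)" using chart_in_atlas[OF c(1)] by (simp add: is_chart_def)
  have rep: "local_rep F' c z = local_rep F c z" if "z \<in> chart_image c" for z
    using assms(2) param_in_topspace[OF c(1) that] by simp
  have fd: "frechet_derivative (local_rep F' c) (at z) = frechet_derivative (local_rep F c) (at z)"
    if "z \<in> chart_image c" for z
    using frechet_derivative_cong_open[OF op that rep] .
  then have pd: "pd i (local_rep F' c) z = pd i (local_rep F c) z" if "z \<in> chart_image c" for i z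
    using that by (simp add: pd_def)
  have "pd i (pd j (local_rep F' c)) x = pd i (pd j (local_rep F c)) x" for i j
    using pd_cong_open[OF op c(2) pd] .
  then have "second_fundamental B N F' c x i j = second_fundamental B N F c x i j" for i j
    unfolding second_fundamental_def normal_space_def by (simp add: rep[OF c(2)] fd[OF c(2)] del: o_apply)
  moreover have "induced_metric B F' c x = induced_metric B F c x"
    by (simp add: induced_metric_def pd[OF c(2)])
  ultimately show ?thesis
    by (simp add: mean_curvature_def Let_def flip: c_def x_def)
qed

lemma mean_curvature_scaleR:
  assumes "p \<in> topspace M" and "s \<noteq> 0"
  shows "mean_curvature B UNIV A (\<lambda>q. s *\<^sub>R F q) p = (1 / s) *\<^sub>R mean_curvature B UNIV A F p"
  using nondegenerate_chart.trace_second_fundamental_scaleR[OF nondegenerate_chart[OF chart_at_point(1,2)], OF assms(1,1,2)]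
  by (simp add: mean_curvature_def Let_def)

lemma nondegenerate_immersion_scaleR:
  assumes "s \<noteq> 0"
  shows "nondegenerate_immersion B A (\<lambda>q. s *\<^sub>R F q)"
proof -
  have "smooth_on (chart_image c) (local_rep (\<lambda>q. s *\<^sub>R F q) c)" if "c \<in> A" for c
    using smooth_on_scaleR_const[of "chart_image c" "local_rep F c" s] immersion that
    by (simp add: nondegenerate_immersion_def smooth_immersion_def o_def)
  moreover have "inj (frechet_derivative (local_rep (\<lambda>q. s *\<^sub>R F q) c) (at x))
      \<and> (\<forall>v. (\<forall>w. B (frechet_derivative (local_rep (\<lambda>q. s *\<^sub>R F q) c) (at x) v)
        (frechet_derivative (local_rep (\<lambda>q. s *\<^sub>R F q) c) (at x) w) = 0) \<longrightarrow> v = 0)"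
    if "c \<in> A" "x \<in> chart_image c" for c x
  proof -
    interpret nondegenerate_chart B "\<lambda>q. s *\<^sub>R F q" c x
      using nondegenerate_chart.nondegenerate_chart_scaleR[OF nondegenerate_chart[OF that] assms] .
    show ?thesis
      using linear_frechet_derivative[OF local_rep_differentiable[OF point_in_chart]]
        differential_nondegenerate
      by (auto simp: linear_injective_0 form.zero_left)
  qed
  ultimately show ?thesis
    by (simp add: nondegenerate_immersion_def smooth_immersion_def Let_def)
qed

lemma normal_part_scaleR:
  assumes "p \<in> topspace M" and "s \<noteq> 0"
  shows "normal_part B A (\<lambda>q. s *\<^sub>R F q) p = s *\<^sub>R normal_part B A F p"
proof -
  interpret nondegenerate_chart B F "chart_at A p" "coord (chart_at A p) p"
    using nondegenerate_chart[OF chart_at_point(1,2)[OF assms(1)]] .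
  show ?thesis
    using assms(2)
    by (simp add: normal_part_def Let_def normal_space_UNIV_scaleR orth_proj_normal_space_UNIV
      tangential_part_scaleR scaleR_diff_right)
qed

end

locale submanifold_of_hyperquadric = nondegenerate_submanifold B M A F
  for B :: "real ^ 'n \<Rightarrow> real ^ 'n \<Rightarrow> real" and M :: "'a topology"
    and A :: "('a, 'm::finite) chart set" and F +
  fixes k :: real
  assumes k_pos: "k > 0" and in_hyperquadric: "\<And>p. p \<in> topspace M \<Longrightarrow> B (F p) (F p) = k"
begin

context
  fixes p assumes p: "p \<in> topspace M"
begin

interpretation nondegenerate_chart B F "chart_at A p" "coord (chart_at A p) p"
  using nondegenerate_chart[OF chart_at_point(1,2)[OF p]] .

lemma local_rep_in_hyperquadric:
  "z \<in> chart_image (chart_at A p) \<Longrightarrow>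
    B (local_rep F (chart_at A p) z) (local_rep F (chart_at A p) z) = k"
  using in_hyperquadric param_in_topspace[OF chart_at_point(1)[OF p]] by simp

lemma mean_curvature_hyperquadric:
  "mean_curvature B (hyperquadric B k) A F p = mean_curvature B UNIV A F p + (real CARD('m) / k) *\<^sub>R F p"
  using trace_second_fundamental_hyperquadric[OF k_pos local_rep_in_hyperquadric]
  by (simp add: mean_curvature_def Let_def chart_at_point(3)[OF p])

lemma mean_curvature_hyperquadric_tangent:
  "B (F p) (mean_curvature B (hyperquadric B k) A F p) = 0"
  using second_fundamental_hyperquadric_tangent[OF k_pos local_rep_in_hyperquadric]
  by (simp add: mean_curvature_def Let_def chart_at_point(3)[OF p] form_simps)

lemma normal_part_position: "normal_part B A F p = F p"
  using position_is_normal_part[OF k_pos local_rep_in_hyperquadric]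
  by (simp add: normal_part_def Let_def chart_at_point(3)[OF p])

end

text \<open>The mean curvature vector in the hyperquadric would be both a multiple of the position vector
  and orthogonal to it, while the position vector is not null.\<close>

lemma mean_curvature_hyperquadric_eq_zeroI:
  assumes "p \<in> topspace M" and "mean_curvature B UNIV A F p = a *\<^sub>R F p"
  shows "mean_curvature B (hyperquadric B k) A F p = 0"
proof -
  have H: "mean_curvature B (hyperquadric B k) A F p = (a + real CARD('m) / k) *\<^sub>R F p"
    using mean_curvature_hyperquadric[OF assms(1)] assms(2) by (simp add: scaleR_add_left)
  have "(a + real CARD('m) / k) * k = 0"
    using mean_curvature_hyperquadric_tangent[OF assms(1)] in_hyperquadric[OF assms(1)]
    unfolding H by (simp add: form_simps)
  then show ?thesis using k_pos H by simp
qed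

text \<open>The homothety equation at time zero makes the mean curvature vector a multiple of the position
  vector, by a factor that comes from the scaling function at that time.\<close>

lemma homothety_imp_minimal:
  assumes flow: "mcf_solution B M A F T \<Phi>" and "homothety B M A T \<Phi>"
  shows "minimal_immersion B (hyperquadric B k) M A F"
proof -
  obtain c where c: "homothety_with B M A T \<Phi> c"
    using assms(2) by (auto simp: homothety_def)
  have 0: "0 \<in> time_interval T"
    using flow by (simp add: mcf_solution_def time_interval_def zero_ereal_def[symmetric])
  define a where "a = - (vector_derivative c (at 0 within time_interval T) / c 0)"
  have init: "\<Phi> q 0 = F q" if "q \<in> topspace M" for q
    using flow that by (simp add: mcf_solution_def)
  interpret initial: submanifold_of_hyperquadric B M A "\<lambda>q. \<Phi> q 0" k
    using flow 0 k_pos in_hyperquadric init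
    by unfold_locales (auto simp: mcf_solution_def manifold)
  have "mean_curvature B (hyperquadric B k) A F p = 0" if p: "p \<in> topspace M" for p
  proof (rule mean_curvature_hyperquadric_eq_zeroI[OF p])
    have "mean_curvature B UNIV A F p = mean_curvature B UNIV A (\<lambda>q. \<Phi> q 0) p"
      using mean_curvature_cong[OF p init] by simp
    also have "\<dots> = a *\<^sub>R normal_part B A (\<lambda>q. \<Phi> q 0) p"
      using c p 0 by (simp add: homothety_with_def a_def)
    also have "\<dots> = a *\<^sub>R F p"
      by (simp add: initial.normal_part_position[OF p] init[OF p])
    finally show "mean_curvature B UNIV A F p = a *\<^sub>R F p" .
  qed
  then show ?thesis
    by (simp add: minimal_immersion_def immersion in_hyperquadric hyperquadric_def)
qed

text \<open>Both claims reduce to the derivatives \<open>s' = - m / (k s)\<close> and \<open>c' / c = m / (k s\<^sup>2)\<close>, where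
  \<open>s = 1 / c\<close>: the first is the coefficient of \<open>F\<close> in the mean curvature vector of \<open>s F\<close>, and the
  second, multiplied by \<open>- s\<close>, is the same coefficient.\<close>

lemma minimal_imp_shrinking_homothety:
  fixes c :: "real \<Rightarrow> real"
  assumes minimal: "minimal_immersion B (hyperquadric B k) M A F"
  defines "m \<equiv> real CARD('m)"
  defines "T \<equiv> ereal (k / (2 * m))"
  assumes c_def: "c = (\<lambda>t. sqrt k * (k - 2 * m * t) powr (- 1 / 2))"
  shows "mcf_solution B M A F T (\<lambda>p t. inverse (c t) *\<^sub>R F p)"
    and "homothety_with B M A T (\<lambda>p t. inverse (c t) *\<^sub>R F p) c"
proof -
  have m: "m > 0" by (simp add: m_def)
  have I: "t \<in> time_interval T \<longleftrightarrow> 0 \<le> t \<and> t < k / (2 * m)" for t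
    by (simp add: time_interval_def T_def)
  define s where "s t = (1 / sqrt k) * (k - 2 * m * t) powr (1 / 2)" for t
  have s: "inverse (c t) = s t" for t
    by (simp add: c_def s_def powr_minus inverse_eq_divide)
  have r: "k - 2 * m * t > 0" if "t \<in> time_interval T" for t
    using that m by (simp add: I field_simps)
  have s_pos: "s t > 0" if "t \<in> time_interval T" for t
    using r[OF that] k_pos by (simp add: s_def)
  have s_square: "k * (s t * s t) = k - 2 * m * t" if "t \<in> time_interval T" for t
    using r[OF that] k_pos by (simp add: s_def powr_half_sqrt)
  have s_deriv: "(s has_real_derivative - (m / (k * s t))) (at t)" if "t \<in> time_interval T" for t
  proof -
    have "(s has_real_derivative (1 / sqrt k) * ((1/2) * (k - 2 * m * t) powr (1/2 - 1) * (- 2 * m))) (at t)"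
      unfolding s_def[abs_def]
    proof (rule DERIV_cmult)
      show "((\<lambda>t. (k - 2 * m * t) powr (1 / 2)) has_real_derivative
          (1/2) * (k - 2 * m * t) powr (1/2 - 1) * (- 2 * m)) (at t)"
      proof -
        have "((\<lambda>t. k - 2 * m * t) has_real_derivative - 2 * m) (at t)"
          by (auto intro!: derivative_eq_intros)
        from DERIV_fun_powr[OF this r[OF that], of "1 / 2"] show ?thesis
          by (simp add: mult.assoc)
      qed
    qed
    also have "(1 / sqrt k) * ((1/2) * (k - 2 * m * t) powr (1/2 - 1) * (- 2 * m)) = - (m / (k * s t))"
    proof -
      have "(k - 2 * m * t) powr (1/2 - 1) = 1 / sqrt (k - 2 * m * t)"
        using r[OF that] powr_minus[of "k - 2 * m * t" "1 / 2"]
        by (simp add: powr_half_sqrt inverse_eq_divide)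
      moreover have "k * s t = (k / sqrt k) * sqrt (k - 2 * m * t)"
        using r[OF that] by (simp add: s_def powr_half_sqrt)
      moreover have "k / sqrt k = sqrt k"
        using k_pos by (simp add: real_div_sqrt)
      ultimately show ?thesis by simp
    qed
    finally show ?thesis .
  qed
  have c_deriv: "(c has_real_derivative m * c t / (k - 2 * m * t)) (at t)" if "t \<in> time_interval T" for t
  proof -
    have "((\<lambda>t. k - 2 * m * t) has_real_derivative - 2 * m) (at t)"
      by (auto intro!: derivative_eq_intros)
    from DERIV_cmult[OF DERIV_fun_powr[OF this r[OF that], of "- 1 / 2"], of "sqrt k"]
    have "(c has_real_derivative
        sqrt k * (- 1 / 2 * (k - 2 * m * t) powr (- 1 / 2 - of_nat 1) * (- 2 * m))) (at t)"
      unfolding c_def .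
    also have "(k - 2 * m * t) powr (- 1 / 2 - of_nat 1) = (k - 2 * m * t) powr (- 1 / 2) / (k - 2 * m * t)"
      using r[OF that] by (simp only: powr_diff of_nat_1 powr_one)
    also have "sqrt k * (- 1 / 2 * (p / d) * (- 2 * m)) = m * (sqrt k * p) / d" for p d :: real
      by simp
    finally show ?thesis
      by (simp only: c_def)
  qed
  have c_eq: "c t = 1 / s t" for t
    using s[of t] by (metis inverse_eq_divide inverse_inverse_eq)
  have H: "mean_curvature B UNIV A (\<lambda>q. s t *\<^sub>R F q) p = - (m / (k * s t)) *\<^sub>R F p"
    if "p \<in> topspace M" "t \<in> time_interval T" for p t
  proof -
    have "mean_curvature B UNIV A F p = - (m / k) *\<^sub>R F p"
      using mean_curvature_hyperquadric[OF that(1)] minimal that(1)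
      by (simp add: minimal_immersion_def m_def eq_neg_iff_add_eq_0)
    then show ?thesis
      using mean_curvature_scaleR[OF that(1), of "s t"] s_pos[OF that(2)] by (simp add: mult.commute)
  qed
  show "mcf_solution B M A F T (\<lambda>p t. inverse (c t) *\<^sub>R F p)"
    unfolding mcf_solution_def s
  proof (intro conjI ballI)
    show "T > 0" using k_pos m by (simp add: T_def)
    show "smooth_on (chart_image d \<times> time_interval T) (\<lambda>(x, t). s t *\<^sub>R F (param d x))" if "d \<in> A" for d
    proof -
      have "smooth_on (chart_image d \<times> time_interval T) (\<lambda>(x, t). s t *\<^sub>R local_rep F d x)"
      proof (rule smooth_on_separated_product[where J = "{t. 0 < k - (2 * m) * t}"])
        show "smooth_on (chart_image d) (local_rep F d)"
          using immersion that by (simp add: nondegenerate_immersion_def smooth_immersion_def)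
        show "open {t. 0 < k - (2 * m) * t}"
          by (intro open_Collect_less continuous_intros)
        show "Ck_on n {t. 0 < k - (2 * m) * t} s" for n
          unfolding s_def[abs_def] by (rule Ck_on_affine_powr)
        show "time_interval T \<subseteq> {t. 0 < k - (2 * m) * t}"
          using r by blast
      qed
      then show ?thesis by simp
    qed
    show "nondegenerate_immersion B A (\<lambda>p. s t *\<^sub>R F p)" if "t \<in> time_interval T" for t
      using s_pos[OF that] by (intro nondegenerate_immersion_scaleR) simp
    show "((\<lambda>t. s t *\<^sub>R F p) has_vector_derivative mean_curvature B UNIV A (\<lambda>q. s t *\<^sub>R F q) p)
        (at t within time_interval T)" if "p \<in> topspace M" "t \<in> time_interval T" for p t
      unfolding H[OF that]
      using has_vector_derivative_scaleR[OF s_deriv[OF that(2)] has_vector_derivative_const]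
      by (auto intro: has_vector_derivative_at_within)
    show "s 0 *\<^sub>R F p = F p" for p
      using k_pos by (simp add: s_def powr_half_sqrt)
  qed
  show "homothety_with B M A T (\<lambda>p t. inverse (c t) *\<^sub>R F p) c"
    unfolding homothety_with_def s
  proof (intro conjI ballI)
    show "c differentiable_on time_interval T"
      unfolding differentiable_on_def
      using c_deriv by (meson differentiable_at_withinI real_differentiable_def)
    show "0 < c t" if "t \<in> time_interval T" for t
      using s_pos[OF that] by (simp add: c_eq)
    show "c 0 = 1" using k_pos by (simp add: c_eq s_def powr_half_sqrt)
    fix p t assume p: "p \<in> topspace M" and t: "t \<in> time_interval T"
    \<comment> \<open>Derivatives within the interval are unique because none of its points is isolated.\<close>
    have "at t within time_interval T \<noteq> bot"
    proof -
      have "at t within {t<..<k / (2 * m)} \<noteq> bot"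
        using t by (simp add: I at_within_eq_bot_iff islimpt_greaterThanLessThan1 flip: trivial_limit_def)
      moreover have "{t<..<k / (2 * m)} \<subseteq> time_interval T"
        using t by (auto simp: I)
      ultimately show ?thesis
        by (metis at_le bot.extremum_uniqueI)
    qed
    then have "vector_derivative c (at t within time_interval T) = m * c t / (k - 2 * m * t)"
      using c_deriv[OF t]
      by (intro vector_derivative_within)
        (auto simp: has_real_derivative_iff_has_vector_derivative intro: has_vector_derivative_at_within)
    then have "vector_derivative c (at t within time_interval T) / c t = m / (k * (s t * s t))"
      using s_pos[OF t] by (simp add: c_eq s_square[OF t])
    then show "mean_curvature B UNIV A (\<lambda>q. s t *\<^sub>R F q) p =
        - (vector_derivative c (at t within time_interval T) / c t) *\<^sub>R normal_part B A (\<lambda>q. s t *\<^sub>R F q) p"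
      using s_pos[OF t] by (simp add: H[OF p t] normal_part_scaleR[OF p] normal_part_position[OF p])
  qed
qed

end

theorem theorem3p7:
  fixes M :: "'a topology" and A :: "('a, 'm::finite) chart set"
    and B :: "real ^ 'n \<Rightarrow> real ^ 'n \<Rightarrow> real"
    and F :: "'a \<Rightarrow> real ^ 'n" and k :: real
  assumes "nondegenerate_form B"
    and "smooth_manifold M A" and "topspace M \<noteq> {}" and "connected_space M" and "orientable M A"
    and "nondegenerate_immersion B A F"
    and "geodesically_complete M A (induced_metric B F)"
    and "k > 0" and "\<forall>p\<in>topspace M. B (F p) (F p) = k"
  shows "((\<exists>T \<Phi>. mcf_solution B M A F T \<Phi> \<and> homothety B M A T \<Phi>) \<longleftrightarrow>
            minimal_immersion B (hyperquadric B k) M A F) \<and>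
         (minimal_immersion B (hyperquadric B k) M A F \<longrightarrow>
           (let m = real CARD('m);
                c = (\<lambda>t. sqrt k * (k - 2 * m * t) powr (- 1 / 2));
                T = ereal (k / (2 * m));
                \<Phi> = (\<lambda>p t. inverse (c t) *\<^sub>R F p)
            in mcf_solution B M A F T \<Phi> \<and> homothety_with B M A T \<Phi> c))"
proof -
  interpret submanifold_of_hyperquadric B M A F k
    using assms by unfold_locales auto
  show ?thesis
  proof (intro conjI iffI impI)
    assume "\<exists>T \<Phi>. mcf_solution B M A F T \<Phi> \<and> homothety B M A T \<Phi>"
    then show "minimal_immersion B (hyperquadric B k) M A F"
      using homothety_imp_minimal by auto
  next
    assume minimal: "minimal_immersion B (hyperquadric B k) M A F"
    note shrinking = minimal_imp_shrinking_homothety[OF minimal refl]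
    show "\<exists>T \<Phi>. mcf_solution B M A F T \<Phi> \<and> homothety B M A T \<Phi>"
      unfolding homothety_def by (intro exI conjI) (rule shrinking)+
    show "let m = real CARD('m);
              c = (\<lambda>t. sqrt k * (k - 2 * m * t) powr (- 1 / 2));
              T = ereal (k / (2 * m));
              \<Phi> = (\<lambda>p t. inverse (c t) *\<^sub>R F p)
          in mcf_solution B M A F T \<Phi> \<and> homothety_with B M A T \<Phi> c"
      unfolding Let_def by (intro conjI shrinking)
  qed
qed

end
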